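(* Let $n \ge 1$ and let $d \geq 2$ be an even integer. Then the function $$A \longmapsto |\!|\!| A |\!|\!|_{d}=\big( h_{d}\big(\lambda_1(A), \lambda_2(A), \ldots, \lambda_n(A)\big)\big)^{1/d}$$ is a norm on the real vector space $\mathrm{H}_n(\mathbb{C})$ of $n\times n$ complex Hermitian matrices.
   Context: $\mathrm{H}_n(\mathbb{C})$ denotes the set of $n\times n$ complex Hermitian matrices, regarded as a real vector space. For $A \in \mathrm{H}_n(\mathbb{C})$, $\lambda_1(A)\ge\lambda_2(A)\ge\cdots\ge\lambda_n(A)$ are its (real) eigenvalues, counted with multiplicity. The complete homogeneous symmetric polynomial of degree $d$ in $n$ variables is $$h_d(x_1,\ldots,x_n)=\sum_{1\le i_1\le\cdots\le i_d\le n}x_{i_1}x_{i_2}\cdots x_{i_d},$$ the sum of all monomials of degree $d$ in $x_1,\ldots,x_n$. It is known (Hunter) that for $d$ even $h_d(\boldsymbol{x})\ge 0$ for all $\boldsymbol{x}\in\mathbb{R}^n$, with equality if and only if $\boldsymbol{x}=\boldsymbol{0}$, so the $d$th root is well defined. *)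

theory Defs
  imports "HOL-Analysis.Analysis" "HOL-Computational_Algebra.Fundamental_Theorem_Algebra"
begin

definition hermitian_matrices :: "(complex ^ 'n ^ 'n) set"
  where "hermitian_matrices = {A. \<forall>i j. A $ i $ j = cnj (A $ j $ i)}"

text \<open>The characteristic polynomial \<open>det (x I - A)\<close>, computed over the polynomial ring.\<close>

definition charpoly :: "'a::comm_ring_1 ^ 'n ^ 'n \<Rightarrow> 'a poly"
  where "charpoly A = det (mat [:0, 1:] - (\<chi> i j. [:A $ i $ j:]))"

text \<open>
  The eigenvalues with (algebraic) multiplicity, in weakly decreasing order.
  This is meant for Hermitian \<open>A\<close>, whose eigenvalues are real (\<open>Im_root_charpoly_hermitian\<close>
  below), so that \<open>Re\<close> only changes the type.
\<close>

definition eigenvalue_list :: "complex ^ 'n ^ 'n \<Rightarrow> real list"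
  where "eigenvalue_list A =
    rev (sorted_list_of_multiset (image_mset Re (proots (charpoly A))))"

text \<open>The index \<open>k\<close> runs through \<open>1, \<dots>, CARD('n)\<close>.\<close>

definition eigval :: "complex ^ 'n ^ 'n \<Rightarrow> nat \<Rightarrow> real"
  where "eigval A k = eigenvalue_list A ! (k - 1)"

text \<open>
  The lists \<open>is\<close> are the index tuples \<open>1 \<le> i\<^sub>1 \<le> \<dots> \<le> i\<^sub>d \<le> n\<close>.
\<close>

definition complete_homogeneous :: "nat \<Rightarrow> nat \<Rightarrow> (nat \<Rightarrow> 'a::comm_semiring_1) \<Rightarrow> 'a"
  where "complete_homogeneous d n x =
    (\<Sum>is | length is = d \<and> sorted is \<and> set is \<subseteq> {1..n}. \<Prod>i\<leftarrow>is. x i)"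

definition hermitian_norm :: "nat \<Rightarrow> complex ^ 'n ^ 'n \<Rightarrow> real"
  where "hermitian_norm d A = root d (complete_homogeneous d CARD('n) (eigval A))"

definition is_norm_on :: "'v::real_vector set \<Rightarrow> ('v \<Rightarrow> real) \<Rightarrow> bool"
  where "is_norm_on V N \<longleftrightarrow>
    subspace V \<and>
    (\<forall>x\<in>V. 0 \<le> N x) \<and>
    (\<forall>x\<in>V. N x = 0 \<longleftrightarrow> x = 0) \<and>
    (\<forall>c. \<forall>x\<in>V. N (c *\<^sub>R x) = \<bar>c\<bar> * N x) \<and>
    (\<forall>x\<in>V. \<forall>y\<in>V. N (x + y) \<le> N x + N y)"

lemma finite_sorted_tuples:
  "finite {is :: nat list. length is = d \<and> sorted is \<and> set is \<subseteq> {1..n}}"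
  by (rule finite_subset[OF _ finite_lists_length_eq[of "{1..n}" d]]) auto

lemma subspace_hermitian_matrices: "subspace (hermitian_matrices :: (complex ^ 'n ^ 'n) set)"
  unfolding subspace_def
proof (intro conjI ballI allI)
  show "0 \<in> (hermitian_matrices :: (complex ^ 'n ^ 'n) set)"
    by (simp add: hermitian_matrices_def)
next
  fix A B :: "complex ^ 'n ^ 'n"
  assume "A \<in> hermitian_matrices" "B \<in> hermitian_matrices"
  then show "A + B \<in> hermitian_matrices"
    unfolding hermitian_matrices_def mem_Collect_eq vector_add_component complex_cnj_add by metis
next
  fix c and A :: "complex ^ 'n ^ 'n"
  assume "A \<in> hermitian_matrices"
  then show "c *\<^sub>R A \<in> hermitian_matrices"
    unfolding hermitian_matrices_def mem_Collect_eq vector_scaleR_component complex_cnj_scaleR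
    by metis
qed

lemma coeff_prod_linear:
  fixes p :: "'b \<Rightarrow> 'a::comm_ring_1 poly"
  assumes "finite S" "\<And>i. i \<in> S \<Longrightarrow> degree (p i) \<le> 1"
  shows "degree (prod p S) \<le> card S \<and> coeff (prod p S) (card S) = (\<Prod>i\<in>S. coeff (p i) 1)"
  using assms
proof (induction S rule: finite_induct)
  case empty
  then show ?case by simp
next
  case (insert a S)
  have dS: "degree (prod p S) \<le> card S"
    and cS: "coeff (prod p S) (card S) = (\<Prod>i\<in>S. coeff (p i) 1)"
    using insert by auto
  have da: "degree (p a) \<le> 1"
    using insert by auto
  obtain u v where pa: "p a = [:u, v:]"
    proof -
    obtain u q where "p a = pCons u q"
      by (cases "p a")
    moreover from this have "degree q = 0"
      using da by (auto split: if_splits)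
    then obtain v where "q = [:v:]"
      using degree_eq_zeroE by blast
    ultimately show thesis
      using that by blast
  qed
  have "degree (p a * prod p S) \<le> Suc (card S)"
    using degree_mult_le[of "p a" "prod p S"] da dS by linarith
  moreover have "coeff (p a * prod p S) (Suc (card S)) = v * coeff (prod p S) (card S)"
    using dS by (simp add: pa coeff_eq_0)
  ultimately show ?case
    using insert cS by (simp add: pa)
qed

lemma charpoly_monic:
  fixes A :: "'a::comm_ring_1 ^ 'n ^ 'n"
  shows "degree (charpoly A) = CARD('n)" "lead_coeff (charpoly A) = 1"
proof -
  define M where "M = mat [:0, 1:] - (\<chi> i j. [:A $ i $ j:])"
  have M: "M $ i $ j = (if i = j then [:- (A $ i $ j), 1:] else [:- (A $ i $ j):])" for i j
    by (simp add: M_def mat_def)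
  have lin: "degree (M $ i $ j) \<le> 1" for i j
    by (simp add: M)
  define T where "T q = (of_int (sign q) :: 'a poly) * (\<Prod>i\<in>UNIV. M $ i $ q i)" for q
  have char: "charpoly A = (\<Sum>q | q permutes (UNIV :: 'n set). T q)"
    by (simp add: charpoly_def det_def M_def T_def)
  have prod_props: "degree (\<Prod>i\<in>UNIV. M $ i $ q i) \<le> CARD('n)"
    "coeff (\<Prod>i\<in>UNIV. M $ i $ q i) CARD('n) = (\<Prod>i\<in>UNIV. coeff (M $ i $ q i) 1)" for q
    using coeff_prod_linear[of "UNIV :: 'n set" "\<lambda>i. M $ i $ q i"] lin by auto
  have degT: "degree (T q) \<le> CARD('n)" for q
    using prod_props(1)[of q] by (simp add: T_def sign_def)
  have coeffT: "coeff (T q) CARD('n) = of_int (sign q) * (\<Prod>i\<in>UNIV. (mat 1 :: 'a ^ 'n ^ 'n) $ i $ q i)"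
    for q
  proof -
    have "coeff (M $ i $ j) 1 = (mat 1 :: 'a ^ 'n ^ 'n) $ i $ j" for i j
      by (simp add: M mat_def)
    then show ?thesis
      using prod_props(2)[of q] by (simp add: T_def sign_def)
  qed
  have deg: "degree (charpoly A) \<le> CARD('n)"
    unfolding char by (rule degree_sum_le) (auto simp: degT)
  have "coeff (charpoly A) CARD('n) = det (mat 1 :: 'a ^ 'n ^ 'n)"
    by (simp add: char coeff_sum coeffT det_def)
  then have one: "coeff (charpoly A) CARD('n) = 1"
    by (simp add: det_I)
  show "degree (charpoly A) = CARD('n)"
    using deg one by (metis le_antisym le_degree zero_neq_one)
  then show "lead_coeff (charpoly A) = 1"
    using one by simp
qed

lemma poly_charpoly: "poly (charpoly A) z = det (mat z - A)"
proof -
  define M where "M = mat [:0, 1:] - (\<chi> i j. [:A $ i $ j:])"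
  have "poly (M $ i $ j) z = (mat z - A) $ i $ j" for i j
    by (simp add: M_def mat_def)
  then have "poly (of_int (sign q) * (\<Prod>i\<in>UNIV. M $ i $ q i)) z =
      of_int (sign q) * (\<Prod>i\<in>UNIV. (mat z - A) $ i $ q i)" for q
    by (simp add: poly_prod sign_def)
  then show ?thesis
    unfolding charpoly_def M_def[symmetric] det_def poly_sum by simp
qed

lemma root_charpoly_iff:
  fixes A :: "'a::field ^ 'n ^ 'n"
  shows "poly (charpoly A) z = 0 \<longleftrightarrow> (\<exists>v. v \<noteq> 0 \<and> A *v v = z *s v)"
proof -
  have "mat z *v v = z *s v" for v :: "'a ^ 'n"
    by (simp add: vec_eq_iff matrix_vector_mult_def mat_def if_distrib[of "\<lambda>x. x * _"] cong: if_cong)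
  then have "(mat z - A) *v v = z *s v - A *v v" for v
    by (simp add: matrix_vector_mult_diff_rdistrib)
  then have ker: "(mat z - A) *v v = 0 \<longleftrightarrow> A *v v = z *s v" for v
    by auto
  have "det (mat z - A) \<noteq> 0 \<longleftrightarrow> (\<forall>v. (mat z - A) *v v = 0 \<longrightarrow> v = 0)"
    by (simp only: invertible_det_nz[symmetric] invertible_left_inverse matrix_left_invertible_ker)
  then show ?thesis
    unfolding poly_charpoly ker by blast
qed

lemma Im_root_charpoly_hermitian:
  assumes "A \<in> hermitian_matrices" "poly (charpoly A) z = 0"
  shows "Im z = 0"
proof -
  obtain v where v: "v \<noteq> 0" "A *v v = z *s v"
    using assms(2) root_charpoly_iff by blast
  define Q where "Q = (\<Sum>i\<in>UNIV. \<Sum>j\<in>UNIV. cnj (v $ i) * A $ i $ j * v $ j)"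
  define r where "r = (\<Sum>i\<in>UNIV. (cmod (v $ i))\<^sup>2)"
  have "Q = (\<Sum>i\<in>UNIV. cnj (v $ i) * (A *v v) $ i)"
    by (simp add: Q_def matrix_vector_mult_def sum_distrib_left mult.assoc)
  also have "\<dots> = z * of_real r"
    by (simp add: v r_def sum_distrib_left complex_norm_square mult_ac del: of_real_power)
  finally have Q: "Q = z * of_real r" .
  have herm: "cnj (A $ i $ j) = A $ j $ i" for i j
    using assms(1) by (metis (mono_tags, lifting) hermitian_matrices_def mem_Collect_eq)
  have "cnj Q = (\<Sum>i\<in>UNIV. \<Sum>j\<in>UNIV. cnj (v $ j) * A $ j $ i * v $ i)"
    by (simp add: Q_def herm mult_ac)
  also have "\<dots> = Q"
    unfolding Q_def by (rule sum.swap)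
  finally have "Im Q = 0"
    by (simp add: complex_eq_iff)
  moreover obtain k where "v $ k \<noteq> 0"
    using v(1) by (auto simp: vec_eq_iff)
  then have "r > 0"
    unfolding r_def by (intro sum_pos2[where i = k]) auto
  ultimately show ?thesis
    using Q by simp
qed

lemma length_eigenvalue_list: "length (eigenvalue_list A) = CARD('n)"
  for A :: "complex ^ 'n ^ 'n"
proof -
  have "length (eigenvalue_list A) = size (mset (eigenvalue_list A))"
    by simp
  also have "\<dots> = size (proots (charpoly A))"
    by (simp only: eigenvalue_list_def mset_rev mset_sorted_list_of_multiset size_image_mset)
  finally show ?thesis
    by (simp only: size_proots_complex charpoly_monic)
qed

lemma mset_eigenvalue_list_hermitian:
  fixes A :: "complex ^ 'n ^ 'n"
  assumes "A \<in> hermitian_matrices"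
  shows "image_mset complex_of_real (mset (eigenvalue_list A)) = proots (charpoly A)"
proof -
  have "charpoly A \<noteq> 0"
    using charpoly_monic(2)[of A] by auto
  then have "complex_of_real (Re z) = z" if "z \<in># proots (charpoly A)" for z
    using that Im_root_charpoly_hermitian[OF assms] by (simp add: complex_eq_iff)
  then have "image_mset (complex_of_real \<circ> Re) (proots (charpoly A)) = proots (charpoly A)"
    by (simp cong: image_mset_cong)
  then show ?thesis
    by (simp add: eigenvalue_list_def multiset.map_comp)
qed

end

theory Submission
  imports Defs "HOL-Probability.Distributions"
begin

text \<open>
  Let \<open>v\<close> be a standard Gaussian vector of \<open>\<complex>\<^sup>n\<close>, regarded as a real space of dimension \<open>2n\<close>, and
  put \<open>q\<^sub>A(v) = \<langle>v, A v\<rangle> / 2\<close>, which is real for Hermitian \<open>A\<close> and depends linearly on \<open>A\<close>. The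
  theorem follows from the identity (\<open>gaussian_quadratic_form_moment\<close>)

    \<open>E [q\<^sub>A(v)\<^sup>d] = d! h\<^sub>d(\<lambda>\<^sub>1(A), \<dots>, \<lambda>\<^sub>n(A))\<close>.

  For even \<open>d\<close> it says that the function of the theorem is, up to the constant \<open>(d!)\<^bsup>-1/d\<^esup>\<close>, the
  \<open>L\<^sup>d\<close> norm of the random variable \<open>q\<^sub>A(v)\<close>. Nonnegativity and homogeneity are then
  immediate, and the triangle inequality follows from the convexity of \<open>x \<mapsto> x\<^sup>d\<close>. If the norm of
  \<open>A\<close> is zero, then \<open>q\<^sub>A\<close> vanishes almost everywhere, hence everywhere because it is continuous,
  and polarization gives \<open>A = 0\<close>.

  The identity holds because the Gaussian measure is invariant under unitary maps
  (\<open>distr_gaussian_isometry\<close>). Diagonalizing \<open>A\<close> by a unitary matrix (\<open>hermitian_diagonalization\<close>) replaces \<open>q\<^sub>A(v)\<close> by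
  \<open>\<Sum>\<^sub>i \<lambda>\<^sub>i t\<^sub>i\<close>, where the variables \<open>t\<^sub>i = \<bar>v\<^sub>i\<bar>\<^sup>2 / 2\<close> are independent with the moments
  \<open>E [t\<^sub>i\<^sup>a] = a!\<close> of an exponential variable. In the multinomial expansion of
  \<open>(\<Sum>\<^sub>i \<lambda>\<^sub>i t\<^sub>i)\<^sup>d\<close> these factorials cancel the denominators of the multinomial coefficients, so that
  every monomial of degree \<open>d\<close> in the \<open>\<lambda>\<^sub>i\<close> receives the same coefficient \<open>d!\<close>
  (\<open>gaussian_weighted_modulus_moment\<close>).
\<close>

section \<open>Lebesgue measure under linear isometries\<close>

lemma nn_integral_lborel_translate:
  fixes g :: "'a::euclidean_space \<Rightarrow> ennreal"
  assumes [measurable]: "g \<in> borel_measurable borel"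
  shows "(\<integral>\<^sup>+x. g (c + x) \<partial>lborel) = (\<integral>\<^sup>+x. g x \<partial>lborel)"
proof -
  have "(\<integral>\<^sup>+x. g (c + x) \<partial>lborel) = (\<integral>\<^sup>+x. g x \<partial>distr lborel borel ((+) c))"
    by (subst nn_integral_distr) auto
  then show ?thesis
    by (simp add: lborel_distr_plus)
qed

text \<open>
  Let \<open>B\<close> be the unit ball, which \<open>f\<close> preserves. Evaluating the double integral of
  \<open>1\<^sub>A(f x) 1\<^sub>B(f x - y)\<close> over \<open>y\<close> first gives the image measure of \<open>A\<close> times the volume of
  \<open>B\<close>; substituting \<open>x + f\<^bsup>-1\<^esup> y\<close> for \<open>x\<close> and then evaluating over \<open>y\<close> first again gives the
  Lebesgue measure of \<open>A\<close> times the volume of \<open>B\<close>. Thus Tonelli's theorem and translation invariance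
  suffice, in any Euclidean space.
\<close>

lemma distr_lborel_isometry:
  fixes f :: "'a::euclidean_space \<Rightarrow> 'a"
  assumes "linear f" and norm_f: "\<And>x. norm (f x) = norm x"
  shows "distr lborel borel f = lborel"
proof (rule measure_eqI)
  have orth: "orthogonal_transformation f"
    using assms by (simp add: orthogonal_transformation)
  have [measurable]: "f \<in> borel_measurable borel"
    using \<open>linear f\<close> by (intro borel_measurable_continuous_onI linear_continuous_on) (simp add: linear_conv_bounded_linear)
  define B where "B = ball (0::'a) 1"
  have [measurable]: "B \<in> sets borel"
    by (simp add: B_def)
  have B0: "emeasure lborel B \<noteq> 0"
    using content_ball_pos[of 1 "0::'a"] by (auto simp: B_def measure_def)
  have Bfin: "emeasure lborel B < \<infinity>"
    using emeasure_lborel_ball_finite[of 0 1] by (simp add: B_def)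
  fix A assume "A \<in> sets (distr lborel borel f)"
  then have [measurable]: "A \<in> sets borel"
    by simp
  have "emeasure (distr lborel borel f) A * emeasure lborel B
      = (\<integral>\<^sup>+x. indicator A (f x) * emeasure lborel B \<partial>lborel)"
    by (subst nn_integral_multc) (auto simp: nn_integral_indicator[symmetric] nn_integral_distr simp del: nn_integral_indicator)
  also have "\<dots> = (\<integral>\<^sup>+x. (\<integral>\<^sup>+y. indicator A (f x) * indicator B (f x - y) \<partial>lborel) \<partial>lborel)"
  proof (rule nn_integral_cong)
    fix x
    have "(\<integral>\<^sup>+y. indicator B (f x - y) \<partial>lborel) = (\<integral>\<^sup>+y. indicator B (f x - (f x + y)) \<partial>lborel)"
      by (rule nn_integral_lborel_translate[symmetric]) measurable
    also have "\<dots> = (\<integral>\<^sup>+y. indicator B y \<partial>lborel)"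
      by (intro nn_integral_cong) (simp add: B_def indicator_def)
    also have "\<dots> = emeasure lborel B"
      by simp
    finally show "indicator A (f x) * emeasure lborel B = (\<integral>\<^sup>+y. indicator A (f x) * indicator B (f x - y) \<partial>lborel)"
      by (simp add: nn_integral_cmult)
  qed
  also have "\<dots> = (\<integral>\<^sup>+y. (\<integral>\<^sup>+x. indicator A (f x) * indicator B (f x - y) \<partial>lborel) \<partial>lborel)"
    by (rule lborel_pair.Fubini') measurable
  also have "\<dots> = (\<integral>\<^sup>+y. (\<integral>\<^sup>+x. indicator A (f x + y) * indicator B x \<partial>lborel) \<partial>lborel)"
  proof (rule nn_integral_cong)
    fix y
    obtain z where z: "f z = y"
      using orthogonal_transformation_surj[OF orth] by (metis surjD)
    have "(\<integral>\<^sup>+x. indicator A (f x) * indicator B (f x - y) \<partial>lborel)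
        = (\<integral>\<^sup>+x. indicator A (f (z + x)) * indicator B (f (z + x) - y) \<partial>lborel)"
      by (rule nn_integral_lborel_translate[symmetric]) measurable
    also have "\<dots> = (\<integral>\<^sup>+x. indicator A (f x + y) * indicator B x \<partial>lborel)"
      by (intro nn_integral_cong)
         (auto simp: linear_add[OF \<open>linear f\<close>] z B_def norm_f indicator_def add.commute)
    finally show "(\<integral>\<^sup>+x. indicator A (f x) * indicator B (f x - y) \<partial>lborel)
        = (\<integral>\<^sup>+x. indicator A (f x + y) * indicator B x \<partial>lborel)" .
  qed
  also have "\<dots> = (\<integral>\<^sup>+x. (\<integral>\<^sup>+y. indicator A (f x + y) * indicator B x \<partial>lborel) \<partial>lborel)"
    by (rule lborel_pair.Fubini') measurable
  also have "\<dots> = (\<integral>\<^sup>+x. emeasure lborel A * indicator B x \<partial>lborel)"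
    using nn_integral_lborel_translate[of "indicator A :: 'a \<Rightarrow> ennreal"]
    by (simp add: nn_integral_multc)
  also have "\<dots> = emeasure lborel A * emeasure lborel B"
    by (simp add: nn_integral_cmult)
  finally show "emeasure (distr lborel borel f) A = emeasure lborel A"
    using B0 Bfin by (auto simp: ennreal_mult_cancel_left mult.commute[of _ "emeasure lborel B"])
qed simp

section \<open>The standard Gaussian measure\<close>

definition gaussian :: "'a::euclidean_space measure"
  where "gaussian = density lborel (\<lambda>v. ennreal (\<Prod>b\<in>Basis. std_normal_density (v \<bullet> b)))"

lemma sets_gaussian [simp, measurable_cong]: "sets gaussian = sets borel"
  by (simp add: gaussian_def)

text \<open>
  The product form gives independent coordinates; this form shows that the density depends only on
  the norm, which is the source of the invariance under isometries.
\<close>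

lemma gaussian_density_eq:
  "(\<Prod>b\<in>Basis. std_normal_density (v \<bullet> b)) =
    (1 / sqrt (2 * pi)) ^ DIM('a) * exp (- (norm v)\<^sup>2 / 2)" for v :: "'a::euclidean_space"
proof -
  have "(norm v)\<^sup>2 = (\<Sum>b\<in>Basis. (v \<bullet> b)\<^sup>2)"
    unfolding power2_norm_eq_inner by (subst euclidean_inner) (simp add: power2_eq_square)
  then have "exp (- (norm v)\<^sup>2 / 2) = (\<Prod>b\<in>Basis. exp (- (v \<bullet> b)\<^sup>2 / 2))"
    by (simp add: sum_divide_distrib exp_sum flip: sum_negf)
  then show ?thesis
    by (simp add: std_normal_density_def prod_dividef power_one_over)
qed

lemma distr_gaussian_isometry:
  fixes f :: "'a::euclidean_space \<Rightarrow> 'a"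
  assumes "linear f" "\<And>x. norm (f x) = norm x"
  shows "distr gaussian borel f = gaussian"
proof -
  have [measurable]: "f \<in> borel_measurable borel"
    using \<open>linear f\<close> by (intro borel_measurable_continuous_onI linear_continuous_on) (simp add: linear_conv_bounded_linear)
  have "distr gaussian borel f = density (distr lborel borel f)
      (\<lambda>v. ennreal (\<Prod>b\<in>Basis. std_normal_density (v \<bullet> b)))"
    by (subst density_distr) (simp_all add: gaussian_def gaussian_density_eq assms)
  then show ?thesis
    by (simp add: distr_lborel_isometry[OF assms] gaussian_def)
qed

lemma has_bochner_integral_lborel_prod:
  fixes f :: "'a::euclidean_space \<Rightarrow> real \<Rightarrow> real"
  assumes f: "\<And>b. b \<in> Basis \<Longrightarrow> has_bochner_integral lborel (f b) (I b)"
  shows "has_bochner_integral lborel (\<lambda>v. \<Prod>b\<in>Basis. f b (v \<bullet> b)) (\<Prod>b\<in>Basis. I b)"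
proof -
  interpret product_sigma_finite "\<lambda>_::'a. lborel :: real measure" ..
  have [measurable]: "f b \<in> borel_measurable borel" if "b \<in> Basis" for b
    using f[OF that] by (auto simp: has_bochner_integral_iff dest: borel_measurable_integrable)
  have "has_bochner_integral (\<Pi>\<^sub>M b\<in>Basis. lborel) (\<lambda>x. \<Prod>b\<in>Basis. f b (x b)) (\<Prod>b\<in>Basis. I b)"
    using f unfolding has_bochner_integral_iff
    by (auto intro!: product_integrable_prod simp: product_integral_prod)
  then have "has_bochner_integral (\<Pi>\<^sub>M b\<in>Basis. lborel)
      (\<lambda>x. \<Prod>b\<in>Basis. f b ((\<Sum>c\<in>Basis. x c *\<^sub>R c) \<bullet> b)) (\<Prod>b\<in>Basis. I b)"
    by (simp only: inner_sum_left_Basis cong: prod.cong)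
  then show ?thesis
    by (subst lborel_eq) (intro has_bochner_integral_distr; measurable)
qed

lemma gaussian_moment_even:
  "has_bochner_integral gaussian (\<lambda>v::'a::euclidean_space. \<Prod>b\<in>Basis. (v \<bullet> b) ^ (2 * m b))
     (\<Prod>b\<in>Basis. fact (2 * m b) / (2 ^ m b * fact (m b)))"
proof -
  have "has_bochner_integral lborel
     (\<lambda>v::'a. \<Prod>b\<in>Basis. std_normal_density (v \<bullet> b) * (v \<bullet> b) ^ (2 * m b))
     (\<Prod>b\<in>Basis. fact (2 * m b) / (2 ^ m b * fact (m b)))"
    by (rule has_bochner_integral_lborel_prod) (rule std_normal_moment_even)
  then show ?thesis
    unfolding gaussian_def
    by (intro has_bochner_integral_density) (auto simp: prod.distrib prod_nonneg)
qed

section \<open>Exponential moments of the squared moduli\<close>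

text \<open>
  The central binomial coefficients are, up to the factor \<open>(-4)\<^sup>k\<close>, the generalized binomial
  coefficients of \<open>-1/2\<close>, so this is Vandermonde's identity for \<open>-1/2 + -1/2 = -1\<close>.
\<close>

lemma sum_central_binomial:
  "(\<Sum>k\<le>a. real ((2 * k) choose k) * real ((2 * (a - k)) choose (a - k))) = 4 ^ a"
proof -
  have c: "real ((2 * k) choose k) = (-4) ^ k * ((-1/2) gchoose k)" for k
  proof (induction k)
    case (Suc k)
    have step: "real (Suc k) * (-1/2 gchoose Suc k) = (-1/2 - real k) * (-1/2 gchoose k)"
      using gbinomial_mult_1[of "-1/2::real" k] by (simp add: algebra_simps)
    moreover have "real (Suc k) * real ((2 * Suc k) choose Suc k) = (4 * real k + 2) * real ((2 * k) choose k)"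
    proof -
      have "Suc k * ((2 * Suc k) choose Suc k) = (2 * Suc k) * (Suc (2 * k) choose k)"
        using Suc_times_binomial[of k "Suc (2 * k)"] by simp
      moreover have "Suc k * (Suc (2 * k) choose k) = Suc (2 * k) * ((2 * k) choose k)"
        using binomial_absorb_comp[of "Suc (2 * k)" k] by simp
      ultimately have "Suc k * (Suc k * ((2 * Suc k) choose Suc k)) = Suc k * ((4 * k + 2) * ((2 * k) choose k))"
        by (simp add: algebra_simps)
      then have "Suc k * ((2 * Suc k) choose Suc k) = (4 * k + 2) * ((2 * k) choose k)"
        unfolding mult_cancel1 by simp
      from arg_cong[OF this, of real] show ?thesis
        by (simp only: of_nat_mult of_nat_add of_nat_numeral)
    qed
    ultimately have "real (Suc k) * real ((2 * Suc k) choose Suc k) =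
        (-4) ^ Suc k * ((-1/2 - real k) * ((-1/2) gchoose k))"
      by (simp only: Suc power_Suc) (simp add: field_simps)
    also have "\<dots> = real (Suc k) * ((-4) ^ Suc k * ((-1/2) gchoose Suc k))"
      unfolding step[symmetric] by (simp only: mult_ac)
    finally show ?case
      by (simp only: mult_cancel_left of_nat_eq_0_iff nat.distinct simp_thms)
  qed simp
  have "(\<Sum>k\<le>a. real ((2 * k) choose k) * real ((2 * (a - k)) choose (a - k)))
      = (\<Sum>k\<le>a. (-4) ^ a * (((-1/2) gchoose k) * ((-1/2) gchoose (a - k))))"
  proof (rule sum.cong)
    fix k assume "k \<in> {..a}"
    then have a: "(-4 :: real) ^ a = (-4) ^ k * (-4) ^ (a - k)"
      by (simp only: power_add[symmetric]) simp
    then show "real ((2 * k) choose k) * real ((2 * (a - k)) choose (a - k))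
        = (-4) ^ a * (((-1/2) gchoose k) * ((-1/2) gchoose (a - k)))"
      by (simp only: c[of k] c[of "a - k"] a mult.left_commute mult.assoc)
  qed simp
  also have "\<dots> = (-4) ^ a * ((-1) gchoose a)"
    using gbinomial_Vandermonde[of "-1/2::real" "-1/2" a]
    by (simp only: sum_distrib_left[symmetric] atLeast0AtMost) simp
  also have "\<dots> = 4 ^ a"
  proof -
    have "((-1::real) gchoose a) = (-1) ^ a"
      using gbinomial_minus[of "1::real" a] binomial_gbinomial[of a a, where 'a = real] by simp
    moreover have "(-4::real) ^ a * (-1) ^ a = 4 ^ a"
      by (simp only: power_mult_distrib[symmetric]) simp
    ultimately show ?thesis
      by simp
  qed
  finally show ?thesis .
qed

lemma prod_Basis_complex_vec:
  "(\<Prod>b\<in>Basis. g b) = (\<Prod>i\<in>UNIV. g (axis i 1) * g (axis i \<i>))"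
  for g :: "complex ^ 'n \<Rightarrow> 'a::comm_monoid_mult"
proof -
  have "(\<Prod>b\<in>(\<Union>i. {axis i 1, axis i \<i>}). g b) = (\<Prod>i\<in>UNIV. \<Prod>b\<in>{axis i 1, axis i \<i>}. g b)"
    by (rule prod.UNION_disjoint) (auto simp: axis_eq_axis)
  moreover have "(\<Union>i. {axis i 1, axis i \<i>}) = (Basis :: (complex ^ 'n) set)"
    by (auto simp: Basis_vec_def Basis_complex_def)
  ultimately show ?thesis
    by (simp add: axis_eq_axis)
qed

text \<open>
  For independent standard normal \<open>x\<close> and \<open>y\<close>, the sum is the expectation of the binomial
  expansion of \<open>((x\<^sup>2 + y\<^sup>2) / 2)\<^sup>a\<close>: half a chi-squared variable with two degrees of freedom has
  the moments of an exponential variable.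
\<close>

lemma sum_binomial_gaussian_moments:
  "(\<Sum>k\<le>a. real (a choose k) / 2 ^ a *
      (fact (2 * k) / (2 ^ k * fact k) * (fact (2 * (a - k)) / (2 ^ (a - k) * fact (a - k))))) = fact a"
proof -
  have c: "fact (2 * k) = real ((2 * k) choose k) * fact k * fact k" for k :: nat
    using binomial_fact[of k "2 * k", where 'a = real] by (simp add: mult_2)
  have "(\<Sum>k\<le>a. real (a choose k) / 2 ^ a *
      (fact (2 * k) / (2 ^ k * fact k) * (fact (2 * (a - k)) / (2 ^ (a - k) * fact (a - k)))))
      = (\<Sum>k\<le>a. fact a / 4 ^ a * (real ((2 * k) choose k) * real ((2 * (a - k)) choose (a - k))))"
  proof (rule sum.cong)
    fix k assume "k \<in> {..a}"
    then have k: "k \<le> a" by simp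
    have "(2::real) ^ a = 2 ^ k * 2 ^ (a - k)"
      using k by (simp only: power_add[symmetric]) simp
    moreover have "(4::real) ^ a = 2 ^ a * 2 ^ a"
      by (simp only: power_mult_distrib[symmetric]) simp
    ultimately have p: "(4::real) ^ a = 2 ^ a * (2 ^ k * 2 ^ (a - k))"
      by metis
    show "real (a choose k) / 2 ^ a *
      (fact (2 * k) / (2 ^ k * fact k) * (fact (2 * (a - k)) / (2 ^ (a - k) * fact (a - k))))
      = fact a / 4 ^ a * (real ((2 * k) choose k) * real ((2 * (a - k)) choose (a - k)))"
      unfolding c binomial_fact[OF k] p by (simp add: field_simps)
  qed simp
  also have "\<dots> = fact a"
    unfolding sum_distrib_left[symmetric] sum_central_binomial by simp
  finally show ?thesis .
qed

text \<open>
  The moments of independent exponential variables. Each factor is expanded binomially in the real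
  and imaginary parts; \<open>\<kappa> i\<close> is the exponent of the squared real part chosen from the \<open>i\<close>th factor.
\<close>

lemma gaussian_modulus_moment:
  "has_bochner_integral gaussian (\<lambda>v::complex ^ 'n. \<Prod>i\<in>UNIV. ((cmod (v $ i))\<^sup>2 / 2) ^ a i)
     (\<Prod>i\<in>UNIV. fact (a i))"
proof -
  define M :: "nat \<Rightarrow> real" where "M k = fact (2 * k) / (2 ^ k * fact k)" for k
  define K where "K = Pi\<^sub>E (UNIV :: 'n set) (\<lambda>i. {..a i})"
  define c where "c \<kappa> = (\<Prod>i\<in>UNIV. real (a i choose \<kappa> i) / 2 ^ a i)" for \<kappa>
  have mono: "has_bochner_integral gaussian
      (\<lambda>v::complex ^ 'n. \<Prod>i\<in>UNIV. Re (v $ i) ^ (2 * \<kappa> i) * Im (v $ i) ^ (2 * (a i - \<kappa> i)))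
      (\<Prod>i\<in>UNIV. M (\<kappa> i) * M (a i - \<kappa> i))" for \<kappa>
  proof -
    \<comment> \<open>the exponents of the chosen monomial, indexed by the real coordinates\<close>
    define m :: "complex ^ 'n \<Rightarrow> nat"
      where "m b = (\<Sum>i\<in>UNIV. if b = axis i 1 then \<kappa> i else if b = axis i \<i> then a i - \<kappa> i else 0)" for b
    have m: "m (axis i 1) = \<kappa> i" "m (axis i \<i>) = a i - \<kappa> i" for i
      by (simp_all add: m_def axis_eq_axis cong: if_cong)
    show ?thesis
      using gaussian_moment_even[of m] by (simp add: prod_Basis_complex_vec m inner_axis inner_complex_def M_def)
  qed
  have "has_bochner_integral gaussian
      (\<lambda>v::complex ^ 'n. \<Sum>\<kappa>\<in>K. c \<kappa> * (\<Prod>i\<in>UNIV. Re (v $ i) ^ (2 * \<kappa> i) * Im (v $ i) ^ (2 * (a i - \<kappa> i))))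
      (\<Sum>\<kappa>\<in>K. c \<kappa> * (\<Prod>i\<in>UNIV. M (\<kappa> i) * M (a i - \<kappa> i)))"
    by (intro has_bochner_integral_sum has_bochner_integral_mult_right mono)
  moreover have "(\<Sum>\<kappa>\<in>K. c \<kappa> * (\<Prod>i\<in>UNIV. Re (v $ i) ^ (2 * \<kappa> i) * Im (v $ i) ^ (2 * (a i - \<kappa> i))))
      = (\<Prod>i\<in>UNIV. ((cmod (v $ i))\<^sup>2 / 2) ^ a i)" for v :: "complex ^ 'n"
  proof -
    have "((cmod (v $ i))\<^sup>2 / 2) ^ a i = (\<Sum>k\<le>a i. real (a i choose k) / 2 ^ a i *
        (Re (v $ i) ^ (2 * k) * Im (v $ i) ^ (2 * (a i - k))))" for i
      by (simp add: cmod_power2 power_divide binomial_ring sum_divide_distrib power_mult mult.assoc)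
    then show ?thesis
      by (simp only: K_def c_def prod.distrib[symmetric]) (subst prod_sum_PiE, simp_all)
  qed
  moreover have "(\<Sum>\<kappa>\<in>K. c \<kappa> * (\<Prod>i\<in>UNIV. M (\<kappa> i) * M (a i - \<kappa> i))) = (\<Prod>i\<in>UNIV. fact (a i))"
  proof -
    have f: "fact (a i) = (\<Sum>k\<le>a i. real (a i choose k) / 2 ^ a i * (M k * M (a i - k)))" for i
      using sum_binomial_gaussian_moments[of "a i"] by (simp add: M_def)
    show ?thesis
      by (simp only: f K_def c_def prod.distrib[symmetric]) (subst prod_sum_PiE, simp_all)
  qed
  ultimately show ?thesis
    by simp
qed

section \<open>Complete homogeneous polynomials as moments\<close>

lemma complete_homogeneous_0 [simp]: "complete_homogeneous 0 n x = 1"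
proof -
  have "{is. length is = 0 \<and> sorted is \<and> set is \<subseteq> {1..n}} = {[]}"
    by auto
  then show ?thesis
    by (simp add: complete_homogeneous_def)
qed

lemma complete_homogeneous_Suc_0 [simp]: "complete_homogeneous (Suc d) 0 x = 0"
proof -
  have "{is. length is = Suc d \<and> sorted is \<and> set is \<subseteq> {1..0::nat}} = {}"
    by auto
  then show ?thesis
    unfolding complete_homogeneous_def by (simp only: sum.empty)
qed

text \<open>
  A sorted index tuple with entries up to \<open>n + 1\<close> either avoids \<open>n + 1\<close> or ends with it.
\<close>

lemma complete_homogeneous_Suc_Suc:
  "complete_homogeneous (Suc d) (Suc n) x =
    complete_homogeneous (Suc d) n x + x (Suc n) * complete_homogeneous d (Suc n) x"
proof -
  define I where "I d n = {is. length is = d \<and> sorted is \<and> set is \<subseteq> {1..n}}" for d n :: nat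
  have fin: "finite (I d n)" for d n
    unfolding I_def by (rule finite_sorted_tuples)
  have split: "I (Suc d) (Suc n) = I (Suc d) n \<union> (\<lambda>is. is @ [Suc n]) ` I d (Suc n)"
  proof (intro equalityI subsetI)
    fix xs assume xs: "xs \<in> I (Suc d) (Suc n)"
    then obtain ys y where ys: "xs = ys @ [y]"
      by (cases xs rule: rev_cases) (auto simp: I_def)
    show "xs \<in> I (Suc d) n \<union> (\<lambda>is. is @ [Suc n]) ` I d (Suc n)"
    proof (cases "y = Suc n")
      case True
      then show ?thesis
        using xs ys by (auto simp: I_def sorted_append)
    next
      case False
      then have "z \<le> n" if "z \<in> set xs" for z
        using xs ys that by (fastforce simp: I_def sorted_append)
      then have "xs \<in> I (Suc d) n"
        using xs by (auto simp: I_def)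
      then show ?thesis ..
    qed
  next
    fix xs assume "xs \<in> I (Suc d) n \<union> (\<lambda>is. is @ [Suc n]) ` I d (Suc n)"
    then show "xs \<in> I (Suc d) (Suc n)"
      by (fastforce simp: I_def sorted_append)
  qed
  have disj: "I (Suc d) n \<inter> (\<lambda>is. is @ [Suc n]) ` I d (Suc n) = {}"
    by (auto simp: I_def)
  have "(\<Sum>is\<in>(\<lambda>is. is @ [Suc n]) ` I d (Suc n). \<Prod>i\<leftarrow>is. x i) = x (Suc n) * (\<Sum>is\<in>I d (Suc n). \<Prod>i\<leftarrow>is. x i)"
    by (subst sum.reindex) (auto simp: inj_on_def sum_distrib_left mult.commute)
  then show ?thesis
    unfolding complete_homogeneous_def I_def[symmetric] split
    by (subst sum.union_disjoint) (auto simp: fin disj)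
qed

lemma complete_homogeneous_expand_last:
  "complete_homogeneous d (Suc n) x = (\<Sum>k\<le>d. x (Suc n) ^ k * complete_homogeneous (d - k) n x)"
proof (induction d)
  case (Suc d)
  have "complete_homogeneous (Suc d) (Suc n) x = complete_homogeneous (Suc d) n x
      + (\<Sum>k\<le>d. x (Suc n) ^ Suc k * complete_homogeneous (d - k) n x)"
    by (simp add: complete_homogeneous_Suc_Suc Suc sum_distrib_left mult.assoc)
  then show ?case
    by (subst sum.atMost_Suc_shift) simp
qed simp

text \<open>
  Induction on the number \<open>m\<close> of variables that are summed: the last one is split off by the
  binomial theorem, and \<open>E [t\<^sup>k] = k!\<close> turns \<open>d choose k\<close> times \<open>k! (d - k)!\<close> into \<open>d!\<close>, which leaves the
  expansion of \<open>h\<^sub>d\<close> in its last variable. The induction carries arbitrary powers of the variables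
  that are not summed yet, in place of an appeal to independence.
\<close>

lemma gaussian_weighted_modulus_moment:
  fixes e :: "'n::finite \<Rightarrow> nat" and x :: "nat \<Rightarrow> real"
  assumes e: "bij_betw e UNIV {1..CARD('n)}"
  shows "has_bochner_integral gaussian
    (\<lambda>v::complex ^ 'n. (\<Sum>i\<in>UNIV. x (e i) * ((cmod (v $ i))\<^sup>2 / 2)) ^ d)
    (fact d * complete_homogeneous d CARD('n) x)"
proof -
  define t where "t v i = (cmod (v $ i))\<^sup>2 / 2" for v :: "complex ^ 'n" and i
  define S where "S m = {i. e i \<le> m}" for m
  have e_range: "1 \<le> e i" "e i \<le> CARD('n)" for i
    using bij_betwE[OF e] by auto
  have main: "has_bochner_integral gaussian
      (\<lambda>v. (\<Sum>i\<in>S m. x (e i) * t v i) ^ d * (\<Prod>i\<in>-S m. t v i ^ a i))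
      (fact d * complete_homogeneous d m x * (\<Prod>i\<in>-S m. fact (a i)))"
    if "m \<le> CARD('n)" for m a d
    using that
  proof (induction m arbitrary: a d)
    case 0
    have S0: "S 0 = {}"
      using e_range(1) by (auto simp: S_def Suc_le_eq)
    show ?case
      using gaussian_modulus_moment[of a] by (cases d) (auto simp: S0 t_def)
  next
    case (Suc m)
    obtain j where j: "e j = Suc m"
      using Suc.prems e by (metis atLeastAtMost_iff bij_betw_iff_bijections le_add1 plus_1_eq_Suc)
    have "e i = Suc m \<longleftrightarrow> i = j" for i
      using bij_betw_imp_inj_on[OF e] j by (metis UNIV_I inj_onD)
    then have SSuc: "S (Suc m) = insert j (S m)"
      by (auto simp: S_def le_Suc_eq)
    have jS: "j \<notin> S m"
      by (simp add: S_def j)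
    have compl: "- S m = insert j (- S (Suc m))" "j \<notin> - S (Suc m)"
      using SSuc jS by auto
    \<comment> \<open>the variable \<open>t\<^sub>j\<close> passes from the product to the sum; \<open>a(j := k)\<close> stores the power of it that
        the binomial expansion produces\<close>
    have split_j: "(\<Prod>i\<in>-S m. f i ((a(j := k)) i)) = f j k * (\<Prod>i\<in>-S (Suc m). f i (a i))"
      for f :: "'n \<Rightarrow> nat \<Rightarrow> real" and k
    proof -
      have "(\<Prod>i\<in>-S (Suc m). f i ((a(j := k)) i)) = (\<Prod>i\<in>-S (Suc m). f i (a i))"
        by (rule prod.cong) (use compl(2) in auto)
      then show ?thesis
        unfolding compl(1) by (subst prod.insert) (use compl(2) in auto)
    qed
    have "has_bochner_integral gaussian
        (\<lambda>v. \<Sum>k\<le>d. real (d choose k) * x (Suc m) ^ k *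
          ((\<Sum>i\<in>S m. x (e i) * t v i) ^ (d - k) * (\<Prod>i\<in>-S m. t v i ^ (a(j := k)) i)))
        (\<Sum>k\<le>d. real (d choose k) * x (Suc m) ^ k *
          (fact (d - k) * complete_homogeneous (d - k) m x * (\<Prod>i\<in>-S m. fact ((a(j := k)) i))))"
      using Suc.prems by (intro has_bochner_integral_sum has_bochner_integral_mult_right Suc.IH) simp
    moreover have "(\<Sum>k\<le>d. real (d choose k) * x (Suc m) ^ k *
          ((\<Sum>i\<in>S m. x (e i) * t v i) ^ (d - k) * (\<Prod>i\<in>-S m. t v i ^ (a(j := k)) i)))
        = (\<Sum>i\<in>S (Suc m). x (e i) * t v i) ^ d * (\<Prod>i\<in>-S (Suc m). t v i ^ a i)" for v
    proof -
      have "(\<Sum>i\<in>S (Suc m). x (e i) * t v i) = x (Suc m) * t v j + (\<Sum>i\<in>S m. x (e i) * t v i)"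
        unfolding SSuc using jS by (simp add: j)
      then show ?thesis
        unfolding split_j[of "\<lambda>i k. t v i ^ k"]
        by (simp add: binomial_ring sum_distrib_left power_mult_distrib mult_ac)
    qed
    moreover have "(\<Sum>k\<le>d. real (d choose k) * x (Suc m) ^ k *
          (fact (d - k) * complete_homogeneous (d - k) m x * (\<Prod>i\<in>-S m. fact ((a(j := k)) i))))
        = fact d * complete_homogeneous d (Suc m) x * (\<Prod>i\<in>-S (Suc m). fact (a i))"
    proof -
      have "real (d choose k) * x (Suc m) ^ k * (fact (d - k) * complete_homogeneous (d - k) m x * (fact k * P))
          = fact d * (x (Suc m) ^ k * complete_homogeneous (d - k) m x) * P" if "k \<in> {..d}" for k P
        using that by (simp add: binomial_fact)
      then show ?thesis
        unfolding complete_homogeneous_expand_last split_j[of "\<lambda>i k. fact k"]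
          sum_distrib_left sum_distrib_right
        by (rule sum.cong[OF refl])
    qed
    ultimately show ?case
      by simp
  qed
  have "S CARD('n) = UNIV"
    using e_range(2) by (auto simp: S_def)
  then show ?thesis
    using main[of "CARD('n)" d] by (simp add: t_def)
qed

section \<open>Diagonalization of Hermitian matrices\<close>

text \<open>
  A maximizer \<open>u\<close> of the Rayleigh quotient on \<open>W\<close>, with value \<open>l\<close>, is an eigenvector: the form of
  \<open>g = l - f\<close> is nonnegative on \<open>W\<close> and vanishes at \<open>u\<close>, so \<open>u\<close> minimizes it there and the gradient
  \<open>2 g u\<close>, which lies in \<open>W\<close>, must vanish.
\<close>

lemma self_adjoint_has_eigenvector:
  fixes f :: "'a::euclidean_space \<Rightarrow> 'a"
  assumes "linear f" and self_adjoint: "\<And>x y. f x \<bullet> y = x \<bullet> f y"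
    and W: "subspace W" "\<And>w. w \<in> W \<Longrightarrow> f w \<in> W" and "w \<in> W" "w \<noteq> 0"
  obtains u l where "u \<in> W" "norm u = 1" "f u = l *\<^sub>R u"
proof -
  define K where "K = W \<inter> sphere 0 1"
  have "compact K"
    unfolding K_def using closed_subspace[OF \<open>subspace W\<close>] by (rule closed_Int_compact) simp
  moreover have "sgn w \<in> K"
    using W(1) \<open>w \<in> W\<close> \<open>w \<noteq> 0\<close> by (simp add: K_def sgn_div_norm subspace_mul)
  moreover have "continuous_on K (\<lambda>x. x \<bullet> f x)"
    by (intro continuous_intros linear_continuous_on) (simp add: \<open>linear f\<close> flip: linear_conv_bounded_linear)
  ultimately obtain u where u: "u \<in> K" and max: "\<And>x. x \<in> K \<Longrightarrow> x \<bullet> f x \<le> u \<bullet> f u"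
    using continuous_attains_sup[of K "\<lambda>x. x \<bullet> f x"] by blast
  define l where "l = u \<bullet> f u"
  define g where "g x = l *\<^sub>R x - f x" for x
  have g_add: "g (x + c *\<^sub>R y) = g x + c *\<^sub>R g y" for x y c
    by (simp add: g_def linear_add[OF \<open>linear f\<close>] linear_scale[OF \<open>linear f\<close>] algebra_simps)
  have g_W: "g x \<in> W" if "x \<in> W" for x
    using that W by (simp add: g_def subspace_diff subspace_mul)
  have uW: "u \<in> W" and norm_u: "norm u = 1"
    using u by (auto simp: K_def)
  have g_u: "u \<bullet> g u = 0"
    using norm_u by (simp add: g_def l_def inner_diff_right norm_eq_1)
  have g_nonneg: "0 \<le> x \<bullet> g x" if "x \<in> W" for x
  proof (cases "x = 0")
    case False
    have "sgn x \<in> K"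
      using W(1) that False by (simp add: K_def sgn_div_norm subspace_mul)
    from max[OF this] have "(x \<bullet> f x) / (norm x)\<^sup>2 \<le> l"
      by (simp add: l_def sgn_div_norm linear_scale[OF \<open>linear f\<close>] power2_eq_square divide_inverse mult_ac)
    then have "x \<bullet> f x \<le> l * (norm x)\<^sup>2"
      using False by (simp add: field_simps)
    then show ?thesis
      by (simp add: g_def inner_diff_right power2_norm_eq_inner)
  qed simp
  have g_self_adjoint: "g x \<bullet> y = x \<bullet> g y" for x y
    by (simp add: g_def inner_diff_left inner_diff_right self_adjoint)
  define y where "y = g u"
  define c where "c = y \<bullet> y"
  define q where "q = y \<bullet> g y"
  have yW: "y \<in> W"
    unfolding y_def by (rule g_W[OF uW])
  have "0 \<le> q"
    unfolding q_def by (rule g_nonneg[OF yW])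
  \<comment> \<open>A short step from \<open>u\<close> along \<open>- y\<close>. The denominator \<open>1 + q\<close> exceeds the minimizing \<open>q\<close>, so it is
      nonzero, and the form is still negative there unless \<open>c = 0\<close>.\<close>
  define s where "s = - c / (1 + q)"
  have "u \<bullet> g y = c"
    unfolding c_def y_def by (simp only: g_self_adjoint)
  then have "(u + s *\<^sub>R y) \<bullet> g (u + s *\<^sub>R y) = 2 * s * c + s\<^sup>2 * q"
    using g_u by (simp add: g_add inner_add_left inner_add_right c_def q_def power2_eq_square
        algebra_simps flip: y_def)
  also have "\<dots> = - (c\<^sup>2 * (2 + q) / (1 + q)\<^sup>2)"
    using \<open>0 \<le> q\<close> by (simp add: s_def power2_eq_square divide_simps) (simp add: algebra_simps)
  finally have "c\<^sup>2 * (2 + q) / (1 + q)\<^sup>2 \<le> 0"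
    using g_nonneg[of "u + s *\<^sub>R y"] uW yW W(1) by (simp add: subspace_add subspace_mul)
  then have "c = 0"
    using \<open>0 \<le> q\<close> by (auto simp: divide_le_0_iff mult_le_0_iff power2_eq_square not_le zero_le_mult_iff
      add_pos_nonneg dest: order_antisym)
  then have "f u = l *\<^sub>R u"
    by (simp add: c_def y_def g_def)
  then show thesis
    using that uW norm_u by blast
qed

definition conj_transpose :: "complex ^ 'm ^ 'n \<Rightarrow> complex ^ 'n ^ 'm"
  where "conj_transpose A = (\<chi> i j. cnj (A $ j $ i))"

lemma inner_conj_transpose:
  "(conj_transpose A *v x) \<bullet> y = x \<bullet> (A *v y)" for A :: "complex ^ 'm ^ 'n"
proof -
  have "(conj_transpose A *v x) \<bullet> y = (\<Sum>j\<in>UNIV. \<Sum>i\<in>UNIV. (cnj (A $ i $ j) * x $ i) \<bullet> (y $ j))"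
    by (simp add: inner_vec_def matrix_vector_mult_def conj_transpose_def inner_sum_left)
  also have "\<dots> = (\<Sum>i\<in>UNIV. \<Sum>j\<in>UNIV. (x $ i) \<bullet> (A $ i $ j * y $ j))"
    by (subst sum.swap) (simp add: inner_complex_def algebra_simps)
  also have "\<dots> = x \<bullet> (A *v y)"
    by (simp add: inner_vec_def matrix_vector_mult_def inner_sum_right)
  finally show ?thesis .
qed

lemma hermitian_conj_transpose: "A \<in> hermitian_matrices \<longleftrightarrow> conj_transpose A = A"
  unfolding hermitian_matrices_def conj_transpose_def vec_eq_iff mem_Collect_eq vec_lambda_beta
  by metis

lemma linear_matrix_vector_mult: "linear (\<lambda>v. A *v v)" for A :: "complex ^ 'm ^ 'n"
  by (rule linearI)
    (simp add: matrix_vector_right_distrib, simp add: vec_eq_iff matrix_vector_mult_def scaleR_sum_right)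

text \<open>
  Real orthogonality to both \<open>u\<close> and \<open>\<i> u\<close> is complex orthogonality to \<open>u\<close>.
\<close>

lemma sum_cnj_mult_eq_inner:
  "(\<Sum>i\<in>UNIV. cnj (u $ i) * v $ i) = Complex (u \<bullet> v) ((\<i> *s u) \<bullet> v)" for u v :: "complex ^ 'n"
  by (simp add: complex_eq_iff inner_vec_def inner_complex_def)

text \<open>
  A new eigenvector is found in the orthogonal complement \<open>W\<close> of the previous ones. The latter are
  joined by their multiples by \<open>\<i>\<close>, so that the real complement is the complex one; \<open>W\<close> is nonzero as
  long as fewer than \<open>n\<close> vectors have been found, since the real dimension of the space is \<open>2n\<close>.
\<close>

lemma hermitian_orthonormal_eigenvectors:
  fixes A :: "complex ^ 'n ^ 'n"
  assumes "A \<in> hermitian_matrices"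
  shows "\<exists>(u :: 'n \<Rightarrow> complex ^ 'n) l. \<forall>i\<in>S. A *v u i = l i *\<^sub>R u i \<and>
    (\<forall>j\<in>S. (\<Sum>k\<in>UNIV. cnj (u i $ k) * u j $ k) = (if i = j then 1 else 0))"
proof -
  have "finite S"
    by simp
  then show ?thesis
  proof (induction S rule: finite_induct)
    case (insert p S)
    then obtain u :: "'n \<Rightarrow> complex ^ 'n" and l where
      eig: "\<And>i. i \<in> S \<Longrightarrow> A *v u i = l i *\<^sub>R u i" and
      orth: "\<And>i j. i \<in> S \<Longrightarrow> j \<in> S \<Longrightarrow> (\<Sum>k\<in>UNIV. cnj (u i $ k) * u j $ k) = (if i = j then 1 else 0)"
      by blast
    define T where "T = u ` S \<union> (\<lambda>i. \<i> *s u i) ` S"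
    define W where "W = {w. \<forall>t\<in>T. t \<bullet> w = 0}"
    have "card S < CARD('n)"
      using insert.hyps by (intro psubset_card_mono) auto
    moreover have "dim T \<le> card T" and "card T \<le> 2 * card S"
      unfolding T_def
      by (auto intro!: dim_le_card' order.trans[OF card_Un_le] add_mono card_image_le simp: mult_2)
    ultimately have "dim T < DIM(complex ^ 'n)"
      by simp
    then obtain w where w: "w \<noteq> 0" "\<And>t. t \<in> span T \<Longrightarrow> orthogonal w t"
      by (rule orthogonal_to_subspace_exists) blast
    have "w \<in> W"
      using w(2) by (auto simp: W_def orthogonal_def inner_commute span_base)
    have self_adjoint: "(A *v x) \<bullet> y = x \<bullet> (A *v y)" for x y
      using inner_conj_transpose[of A x y] assms by (simp add: hermitian_conj_transpose)
    have inv: "A *v x \<in> W" if "x \<in> W" for x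
    proof -
      have "\<exists>r. A *v t = r *\<^sub>R t" if "t \<in> T" for t
      proof -
        have "A *v (\<i> *s u i) = l i *\<^sub>R (\<i> *s u i)" if "i \<in> S" for i
          using eig[OF that] by (simp add: vector_scalar_commute vec_eq_iff)
        then show ?thesis
          using \<open>t \<in> T\<close> eig unfolding T_def by blast
      qed
      then have "t \<bullet> (A *v x) = 0" if "t \<in> T" for t
        using that \<open>x \<in> W\<close> by (fastforce simp: W_def simp flip: self_adjoint)
      then show ?thesis
        by (simp add: W_def)
    qed
    have "subspace W"
      by (auto simp: W_def subspace_def inner_add_right)
    then obtain q r where q: "q \<in> W" "norm q = 1" "A *v q = r *\<^sub>R q"
      using self_adjoint_has_eigenvector[OF linear_matrix_vector_mult self_adjoint _ inv \<open>w \<in> W\<close> \<open>w \<noteq> 0\<close>]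
      by blast
    have uq: "(\<Sum>k\<in>UNIV. cnj (u i $ k) * q $ k) = 0" if "i \<in> S" for i
      using q(1) that by (auto simp: sum_cnj_mult_eq_inner W_def T_def complex_eq_iff)
    then have qu: "(\<Sum>k\<in>UNIV. cnj (q $ k) * u i $ k) = 0" if "i \<in> S" for i
      using arg_cong[OF uq[OF that], of cnj] by (simp add: mult.commute)
    have "(\<i> *s q) \<bullet> q = 0"
      by (simp add: inner_vec_def inner_complex_def)
    then have qq: "(\<Sum>k\<in>UNIV. cnj (q $ k) * q $ k) = 1"
      using q(2) by (simp add: sum_cnj_mult_eq_inner complex_eq_iff norm_eq_1)
    show ?case
    proof (intro exI[of _ "u(p := q)"] exI[of _ "l(p := r)"] ballI conjI)
      fix i assume "i \<in> insert p S"
      then show "A *v (u(p := q)) i = (l(p := r)) i *\<^sub>R (u(p := q)) i"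
        using eig q(3) by auto
      fix j assume "j \<in> insert p S"
      with \<open>i \<in> insert p S\<close> show
        "(\<Sum>k\<in>UNIV. cnj ((u(p := q)) i $ k) * (u(p := q)) j $ k) = (if i = j then 1 else 0)"
        using orth uq qu qq insert.hyps by auto
    qed
  qed simp
qed

definition diagonal_matrix :: "('n \<Rightarrow> real) \<Rightarrow> complex ^ 'n ^ 'n"
  where "diagonal_matrix l = (\<chi> i j. if i = j then of_real (l i) else 0)"

lemma hermitian_diagonalization:
  fixes A :: "complex ^ 'n ^ 'n"
  assumes "A \<in> hermitian_matrices"
  obtains U :: "complex ^ 'n ^ 'n" and l where "conj_transpose U ** U = mat 1" "A ** U = U ** diagonal_matrix l"
proof -
  obtain u :: "'n \<Rightarrow> complex ^ 'n" and l where
    eig: "\<And>i. A *v u i = l i *\<^sub>R u i" and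
    orth: "\<And>i j. (\<Sum>k\<in>UNIV. cnj (u i $ k) * u j $ k) = (if i = j then 1 else 0)"
    using hermitian_orthonormal_eigenvectors[OF assms, of UNIV] by blast
  define U :: "complex ^ 'n ^ 'n" where "U = (\<chi> i j. u j $ i)"
  have "conj_transpose U ** U = mat 1"
    by (simp add: U_def conj_transpose_def matrix_matrix_mult_def mat_def orth)
  moreover have "A ** U = U ** diagonal_matrix l"
  proof -
    have "(\<Sum>k\<in>UNIV. A $ i $ k * u j $ k) = l j *\<^sub>R u j $ i" for i j
      using arg_cong[OF eig[of j], of "\<lambda>v. v $ i"] by (simp add: matrix_vector_mult_def)
    then show ?thesis
      by (simp add: vec_eq_iff U_def diagonal_matrix_def matrix_matrix_mult_def if_distrib[of "\<lambda>x. _ * x"] scaleR_conv_of_real mult.commute cong: if_cong)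
  qed
  ultimately show thesis
    by (rule that)
qed

lemma proots_charpoly_diagonalized:
  fixes A U :: "complex ^ 'n ^ 'n"
  assumes "conj_transpose U ** U = mat 1" "A ** U = U ** diagonal_matrix l"
  shows "proots (charpoly A) = image_mset (\<lambda>i. of_real (l i)) (mset_set UNIV)"
proof -
  have "invertible U"
    using assms(1) by (metis invertible_left_inverse)
  then have det: "det U \<noteq> 0"
    by (simp add: invertible_det_nz)
  have "poly (charpoly A) z = poly (\<Prod>i\<in>UNIV. [:- of_real (l i), 1:]) z" for z
  proof -
    have "mat z ** U = U ** mat z"
      by (simp add: vec_eq_iff matrix_matrix_mult_def mat_def if_distrib[of "\<lambda>x. x * _"]
        if_distrib[of "\<lambda>x. _ * x"] mult.commute cong: if_cong)
    then have "(mat z - A) ** U = U ** (mat z - diagonal_matrix l)"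
      using assms(2) by (simp add: vec_eq_iff matrix_matrix_mult_def algebra_simps sum_subtractf)
    from arg_cong[OF this, of det] have "det (mat z - A) = det (mat z - diagonal_matrix l)"
      using det by (simp add: det_mul mult.commute)
    also have "\<dots> = (\<Prod>i\<in>UNIV. z - of_real (l i))"
      by (subst det_diagonal) (auto simp: mat_def diagonal_matrix_def)
    finally show ?thesis
      by (simp add: poly_charpoly poly_prod)
  qed
  then have "charpoly A = (\<Prod>i\<in>UNIV. [:- of_real (l i), 1:])"
    by (intro poly_eq_poly_eq_iff[THEN iffD1]) auto
  then show ?thesis
    by (simp add: proots_prod sum_unfold_sum_mset)
qed

text \<open>
  The diagonal entries and the sorted eigenvalue list are the same multiset, so some enumeration of
  the index type \<open>'n\<close> by \<open>1, \<dots>, n\<close> matches them.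
\<close>

lemma eigval_enumerates_diagonal:
  fixes A U :: "complex ^ 'n ^ 'n"
  assumes "conj_transpose U ** U = mat 1" "A ** U = U ** diagonal_matrix l"
  obtains e where "bij_betw e (UNIV :: 'n set) {1..CARD('n)}" "\<And>i. l i = eigval A (e i)"
proof -
  obtain b where b: "bij_betw b (UNIV :: 'n set) {0..<CARD('n)}"
    using ex_bij_betw_finite_nat[of "UNIV :: 'n set"] by auto
  define xs where "xs = eigenvalue_list A"
  have len: "length xs = CARD('n)"
    by (simp add: xs_def length_eigenvalue_list)
  have "image_mset l (mset_set UNIV) = mset xs"
    by (simp add: xs_def eigenvalue_list_def proots_charpoly_diagonalized[OF assms] multiset.map_comp o_def)
  also have "\<dots> = image_mset (\<lambda>i. xs ! i) (mset_set {0..<CARD('n)})"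
    using arg_cong[OF map_nth[of xs], of mset] by (simp add: len)
  also have "mset_set {0..<CARD('n)} = image_mset b (mset_set UNIV)"
    using b by (simp add: image_mset_mset_set bij_betw_def)
  finally have "image_mset l (mset_set UNIV) = image_mset (\<lambda>i. xs ! b i) (mset_set UNIV)"
    by (simp add: multiset.map_comp o_def)
  then obtain p where p: "p permutes UNIV" "\<And>i. l i = xs ! b (p i)"
    using image_mset_eq_implies_permutes[of "UNIV :: 'n set" l "\<lambda>i. xs ! b i"] by auto
  show thesis
  proof
    have "bij_betw (b \<circ> p) UNIV {0..<CARD('n)}"
      using permutes_imp_bij[OF p(1)] b by (rule bij_betw_trans)
    moreover have "bij_betw Suc {0..<CARD('n)} {1..CARD('n)}"
      by (simp add: bij_betw_def image_Suc_atLeastLessThan atLeastLessThanSuc_atLeastAtMost)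
    ultimately show "bij_betw (Suc \<circ> (b \<circ> p)) UNIV {1..CARD('n)}"
      by (rule bij_betw_trans)
    show "l i = eigval A ((Suc \<circ> (b \<circ> p)) i)" for i
      by (simp add: p(2) eigval_def xs_def)
  qed
qed

section \<open>Moments of the quadratic form\<close>

text \<open>
  The factor \<open>1/2\<close> makes the squared moduli of the Gaussian coordinates exponential variables of mean 1.
\<close>

definition quadratic_form :: "complex ^ 'n ^ 'n \<Rightarrow> complex ^ 'n \<Rightarrow> real"
  where "quadratic_form A v = v \<bullet> (A *v v) / 2"

text \<open>
  By unitary invariance \<open>A\<close> may be assumed diagonal.
\<close>

lemma gaussian_quadratic_form_moment:
  fixes A :: "complex ^ 'n ^ 'n"
  assumes "A \<in> hermitian_matrices"
  shows "has_bochner_integral gaussian (\<lambda>v. quadratic_form A v ^ d)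
    (fact d * complete_homogeneous d CARD('n) (eigval A))"
proof -
  obtain U :: "complex ^ 'n ^ 'n" and l where U: "conj_transpose U ** U = mat 1" and D: "A ** U = U ** diagonal_matrix l"
    using hermitian_diagonalization[OF assms] .
  obtain e where e: "bij_betw e (UNIV :: 'n set) {1..CARD('n)}" "\<And>i. l i = eigval A (e i)"
    using eigval_enumerates_diagonal[OF U D] by blast
  have inner_U: "(U *v x) \<bullet> (U *v y) = x \<bullet> y" for x y
    by (metis U inner_conj_transpose matrix_vector_mul_assoc matrix_vector_mul_lid)
  have "(U *v v) \<bullet> (A *v (U *v v)) = (\<Sum>i\<in>UNIV. l i * (cmod (v $ i))\<^sup>2)" for v
  proof -
    have "(U *v v) \<bullet> (A *v (U *v v)) = (U *v v) \<bullet> (U *v (diagonal_matrix l *v v))"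
      by (simp add: matrix_vector_mul_assoc D)
    also have "\<dots> = v \<bullet> (diagonal_matrix l *v v)"
      by (rule inner_U)
    also have "\<dots> = (\<Sum>i\<in>UNIV. l i * (cmod (v $ i))\<^sup>2)"
    proof -
      have "(diagonal_matrix l *v v) $ i = l i *\<^sub>R v $ i" for i
        by (simp add: matrix_vector_mult_def diagonal_matrix_def if_distrib[of "\<lambda>x. x * _"]
          scaleR_conv_of_real cong: if_cong)
      then show ?thesis
        by (simp add: inner_vec_def power2_norm_eq_inner)
    qed
    finally show ?thesis .
  qed
  then have "(U *v v) \<bullet> (A *v (U *v v)) / 2 = (\<Sum>i\<in>UNIV. eigval A (e i) * ((cmod (v $ i))\<^sup>2 / 2))" for v
    by (simp add: e(2) sum_divide_distrib)
  then have *: "has_bochner_integral gaussian (\<lambda>v. ((U *v v) \<bullet> (A *v (U *v v)) / 2) ^ d)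
      (fact d * complete_homogeneous d CARD('n) (eigval A))"
    using gaussian_weighted_modulus_moment[OF e(1), of "eigval A" d] by simp
  have [measurable]: "(\<lambda>v. M *v v) \<in> borel_measurable borel" for M :: "complex ^ 'n ^ 'n"
    using linear_matrix_vector_mult[of M]
    by (intro borel_measurable_continuous_onI linear_continuous_on) (simp add: linear_conv_bounded_linear)
  have "distr gaussian borel (\<lambda>v. U *v v) = gaussian"
    by (rule distr_gaussian_isometry[OF linear_matrix_vector_mult]) (simp add: norm_eq_sqrt_inner inner_U)
  moreover have "has_bochner_integral (distr gaussian borel (\<lambda>v. U *v v)) (\<lambda>v. (v \<bullet> (A *v v) / 2) ^ d)
      (fact d * complete_homogeneous d CARD('n) (eigval A))"
    by (rule has_bochner_integral_distr) (measurable, rule *)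
  ultimately show ?thesis
    by (simp add: quadratic_form_def)
qed

section \<open>The norm\<close>

text \<open>
  The density is positive, so the open set where \<open>f\<close> is nonzero has Lebesgue measure zero, hence is empty.
\<close>

lemma AE_gaussian_eq_zero_imp_eq_zero:
  fixes f :: "'a::euclidean_space \<Rightarrow> real"
  assumes "continuous_on UNIV f" and ae: "AE v in gaussian. f v = 0"
  shows "f v = 0"
proof -
  have "AE v::'a in lborel. 0 < ennreal (\<Prod>b\<in>Basis. std_normal_density (v \<bullet> b)) \<longrightarrow> f v = 0"
    using ae unfolding gaussian_def by (subst (asm) AE_density) auto
  then have "AE v in lborel. f v = 0"
    by eventually_elim (auto simp: prod_pos normal_density_pos)
  then have "AE v in lebesgue. f v = 0"
    by (rule AE_completion)
  then obtain N where "negligible N" "{v. f v \<noteq> 0} \<subseteq> N"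
    unfolding eventually_ae_filter_negligible by blast
  then have "negligible {v. f v \<noteq> 0}"
    by (rule negligible_subset)
  moreover have "open {v. f v \<noteq> 0}"
    using open_Collect_neq[OF assms(1) continuous_on_const[of UNIV 0]] .
  ultimately have "{v. f v \<noteq> 0} = {}"
    using open_not_negligible by blast
  then show ?thesis
    by blast
qed

text \<open>
  Polarization with \<open>y = A x\<close> isolates the term \<open>2 \<langle>y, A x\<rangle> = 2 \<parallel>A x\<parallel>\<^sup>2\<close>, which therefore vanishes.
\<close>

lemma hermitian_eq_zero_of_quadratic_form:
  fixes A :: "complex ^ 'n ^ 'n"
  assumes "A \<in> hermitian_matrices" and q: "\<And>v. v \<bullet> (A *v v) = 0"
  shows "A = 0"
proof -
  have self_adjoint: "(A *v x) \<bullet> y = x \<bullet> (A *v y)" for x y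
    using inner_conj_transpose[of A x y] assms(1) by (simp add: hermitian_conj_transpose)
  have "A *v x = 0" for x
  proof -
    define y where "y = A *v x"
    have "(x + y) \<bullet> (A *v (x + y)) = x \<bullet> (A *v x) + y \<bullet> (A *v y) + 2 * (y \<bullet> (A *v x))"
      using self_adjoint[of y x]
      by (simp add: matrix_vector_right_distrib inner_add_left inner_add_right inner_commute)
    then have "y \<bullet> (A *v x) = 0"
      by (simp only: q)
    then show ?thesis
      by (simp add: y_def)
  qed
  then show ?thesis
    by (simp add: matrix_eq)
qed

lemma quadratic_form_add: "quadratic_form (A + B) v = quadratic_form A v + quadratic_form B v"
  by (simp add: quadratic_form_def matrix_vector_mult_add_rdistrib inner_add_right add_divide_distrib)

lemma quadratic_form_scaleR: "quadratic_form (c *\<^sub>R A) v = c * quadratic_form A v"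
proof -
  have "(c *\<^sub>R A) *v v = c *\<^sub>R (A *v v)"
    by (simp add: vec_eq_iff matrix_vector_mult_def scaleR_sum_right)
  then show ?thesis
    by (simp add: quadratic_form_def)
qed

lemma continuous_on_quadratic_form: "continuous_on S (quadratic_form A)"
  unfolding quadratic_form_def
  by (intro continuous_intros linear_continuous_on)
     (use linear_matrix_vector_mult[of A] in \<open>simp_all add: linear_conv_bounded_linear\<close>)

theorem theorem1:
  fixes d :: nat
  assumes "d \<ge> 2" and "even d"
  shows "is_norm_on (hermitian_matrices :: (complex ^ 'n ^ 'n) set)
           (\<lambda>A. hermitian_norm d A)"
proof -
  let ?H = "hermitian_matrices :: (complex ^ 'n ^ 'n) set"
  define N where "N = (hermitian_norm d :: complex ^ 'n ^ 'n \<Rightarrow> real)"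
  define I where "I A = (\<integral>v. quadratic_form A v ^ d \<partial>gaussian)" for A :: "complex ^ 'n ^ 'n"
  have "d > 0"
    using \<open>d \<ge> 2\<close> by simp
  have int: "integrable gaussian (\<lambda>v. quadratic_form A v ^ d)" if "A \<in> ?H" for A
    using gaussian_quadratic_form_moment[OF that, of d] by (simp add: has_bochner_integral_iff quadratic_form_def)
  have N_eq: "N A = root d (I A / fact d)" if "A \<in> ?H" for A
    using gaussian_quadratic_form_moment[OF that, of d]
    by (simp add: has_bochner_integral_iff quadratic_form_def N_def I_def hermitian_norm_def)
  have I_nonneg: "0 \<le> I A" for A
    using \<open>even d\<close> unfolding I_def by (intro integral_nonneg_AE) (simp add: zero_le_even_power)
  have N_nonneg: "0 \<le> N A" if "A \<in> ?H" for A
    using I_nonneg by (simp add: N_eq[OF that] real_root_ge_zero)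
  have I_N: "I A = fact d * N A ^ d" if "A \<in> ?H" for A
    using I_nonneg \<open>d > 0\<close> by (simp add: N_eq[OF that])
  have I_scaleR: "I (c *\<^sub>R A) = c ^ d * I A" for c A
    by (simp add: I_def quadratic_form_scaleR power_mult_distrib)
  have add_H: "A + B \<in> ?H" and scaleR_H: "c *\<^sub>R A \<in> ?H" if "A \<in> ?H" "B \<in> ?H" for A B c
    using subspace_hermitian_matrices that by (auto intro: subspace_add subspace_mul)
  have N_scaleR: "N (c *\<^sub>R A) = \<bar>c\<bar> * N A" if "A \<in> ?H" for c A
  proof -
    have "N (c *\<^sub>R A) = root d (\<bar>c\<bar> ^ d * (I A / fact d))"
      using \<open>even d\<close> scaleR_H[OF that that] by (simp add: N_eq I_scaleR power_even_abs)
    also have "\<dots> = \<bar>c\<bar> * N A"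
      unfolding real_root_mult using \<open>d > 0\<close> that by (simp add: N_eq real_root_power_cancel)
    finally show ?thesis .
  qed
  have definite: "A = 0" if "A \<in> ?H" "N A = 0" for A
  proof -
    have "I A = 0"
      using that \<open>d > 0\<close> by (simp add: I_N)
    then have "AE v in gaussian. quadratic_form A v ^ d = 0"
      using int[OF that(1)] \<open>even d\<close> unfolding I_def
      by (subst (asm) integral_nonneg_eq_0_iff_AE) (simp_all add: zero_le_even_power)
    then have "quadratic_form A v = 0" for v
      using \<open>d > 0\<close> by (intro AE_gaussian_eq_zero_imp_eq_zero[OF continuous_on_quadratic_form]) simp
    then show ?thesis
      using that(1) by (intro hermitian_eq_zero_of_quadratic_form) (auto simp: quadratic_form_def)
  qed
  \<comment> \<open>Convexity of \<open>x \<mapsto> x\<^sup>d\<close> bounds \<open>N\<close> by 1 on segments between vectors of norm 1; by homogeneity this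
      is the triangle inequality.\<close>
  have convex: "N (s *\<^sub>R A + t *\<^sub>R B) \<le> 1"
    if "A \<in> ?H" "B \<in> ?H" "N A = 1" "N B = 1" "0 \<le> s" "0 \<le> t" "s + t = 1" for A B s t
  proof -
    have s: "s = 1 - t"
      using \<open>s + t = 1\<close> by simp
    have H: "s *\<^sub>R A + t *\<^sub>R B \<in> ?H"
      using that by (intro add_H scaleR_H)
    have "I (s *\<^sub>R A + t *\<^sub>R B) \<le> (\<integral>v. s * quadratic_form A v ^ d + t * quadratic_form B v ^ d \<partial>gaussian)"
      unfolding I_def
    proof (rule integral_mono)
      show "quadratic_form (s *\<^sub>R A + t *\<^sub>R B) v ^ d \<le> s * quadratic_form A v ^ d + t * quadratic_form B v ^ d" for v
        using convex_onD[OF convex_power_even[OF \<open>even d\<close>], of t "quadratic_form A v" "quadratic_form B v"]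
          \<open>0 \<le> s\<close> \<open>0 \<le> t\<close> s
        by (simp add: quadratic_form_add quadratic_form_scaleR)
    qed (use int that H in auto)
    also have "\<dots> = s * I A + t * I B"
      using int that by (simp add: I_def)
    also have "\<dots> = fact d"
      using that by (simp add: I_N s algebra_simps)
    finally have "fact d * N (s *\<^sub>R A + t *\<^sub>R B) ^ d \<le> fact d * 1 ^ d"
      using I_N[OF H] by simp
    then show ?thesis
      using N_nonneg[OF H] \<open>d > 0\<close> by (simp add: power_le_one_iff)
  qed
  have triangle: "N (A + B) \<le> N A + N B" if AB: "A \<in> ?H" "B \<in> ?H" for A B
  proof (cases "A = 0 \<or> B = 0")
    case True
    then show ?thesis
      using AB N_nonneg by auto
  next
    case False
    define a b where "a = N A" and "b = N B"
    have "a > 0" "b > 0"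
      using False definite AB N_nonneg by (force simp: a_def b_def less_le)+
    have "N ((a / (a + b)) *\<^sub>R (inverse a *\<^sub>R A) + (b / (a + b)) *\<^sub>R (inverse b *\<^sub>R B)) \<le> 1"
      using \<open>a > 0\<close> \<open>b > 0\<close> AB
      by (intro convex scaleR_H) (simp_all add: N_scaleR a_def b_def divide_simps)
    also have "(a / (a + b)) *\<^sub>R (inverse a *\<^sub>R A) + (b / (a + b)) *\<^sub>R (inverse b *\<^sub>R B) = inverse (a + b) *\<^sub>R (A + B)"
    proof -
      have "a / (a + b) * inverse a = inverse (a + b)" "b / (a + b) * inverse b = inverse (a + b)"
        using \<open>a > 0\<close> \<open>b > 0\<close> by (simp_all add: inverse_eq_divide)
      then show ?thesis
        by (simp only: scaleR_scaleR scaleR_add_right)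
    qed
    also have "N (inverse (a + b) *\<^sub>R (A + B)) = inverse (a + b) * N (A + B)"
      using \<open>a > 0\<close> \<open>b > 0\<close> AB by (simp only: N_scaleR add_H) simp
    finally have "N (A + B) \<le> a + b"
      using \<open>a > 0\<close> \<open>b > 0\<close> by (simp add: field_simps)
    then show ?thesis
      by (simp add: a_def b_def)
  qed
  have "N 0 = 0"
    using N_scaleR[of 0 0] subspace_0[OF subspace_hermitian_matrices] by simp
  then show ?thesis
    unfolding is_norm_on_def N_def[symmetric]
    using subspace_hermitian_matrices N_nonneg definite N_scaleR triangle by blast
qed

end
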